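(* Let $(X,d)$ be a metric space with base point $x_0$, and suppose that $f:X\to X$ is a semi-contraction with $d(f):=\inf_{x\in X} d(x,f(x))=0$. Then there is a metric functional $h$ of $X$ such that $$h(f(x))\leq h(x)$$ for all $x\in X$.
   Context: A semi-contraction is a map $f$ between metric spaces with $d(f(x_1),f(x_2))\le d(x_1,x_2)$ for all $x_1,x_2$ (a 1-Lipschitz map). For $x\in X$ define $h_x:X\to\mathbb{R}$ by $h_x(y)=d(y,x)-d(x_0,x)$. The metric functionals of $X$ are the elements of the closure $\overline{X}$ of $\{h_x:x\in X\}$ in $\mathbb{R}^X$ with the topology of pointwise convergence. *)

theory Defs
  imports "HOL-Analysis.Analysis"
begin

definition semi_contraction :: "('a::metric_space \<Rightarrow> 'b::metric_space) \<Rightarrow> bool" where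
  "semi_contraction f \<longleftrightarrow> (\<forall>x y. dist (f x) (f y) \<le> dist x y)"

definition min_displacement :: "('a::metric_space \<Rightarrow> 'a) \<Rightarrow> real" where
  "min_displacement f = (INF x. dist x (f x))"

definition internal_functional :: "'a::metric_space \<Rightarrow> 'a \<Rightarrow> 'a \<Rightarrow> real" where
  "internal_functional x0 x = (\<lambda>y. dist y x - dist x0 x)"

(* The topology on the function type 'a => real is the product topology, that is, the topology of
   pointwise convergence (type class instance in HOL-Analysis.Function_Topology). *)
definition metric_functionals :: "'a::metric_space \<Rightarrow> ('a \<Rightarrow> real) set" where
  "metric_functionals x0 = closure (range (internal_functional x0))"

end

theory Submission
  imports Defs
begin

text \<open>
  Since the infimum of the displacement is zero, there are points $z_n$ that are moved by less than
  $1/(n+1)$. The triangle inequality and the semi-contraction property show that the internal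
  functional $h$ of such a point $z$ satisfies $h(f(x)) \le h(x) + d(z, f(z))$ for every $x$
  simultaneously (\<open>internal_functional_image_le\<close>): the defect is the displacement of $z$ and
  does not depend on $x$. All internal functionals lie in the box of functions bounded by
  $|h(y)| \le d(x_0, y)$, which is compact for pointwise convergence by Tychonoff's theorem
  (\<open>compact_box\<close>). The functionals of the $z_n$ therefore have a cluster point. For
  fixed $x$ and $e > 0$ the condition $h(f(x)) \le h(x) + e$ is closed and holds for almost all of
  them, hence it passes to the cluster point, and $e$ was arbitrary.
\<close>

lemma internal_functional_image_le:
  assumes "semi_contraction f"
  shows "internal_functional x0 z (f x) \<le> internal_functional x0 z x + dist z (f z)"
proof -
  have "dist (f x) z \<le> dist (f x) (f z) + dist z (f z)"
    by (rule dist_triangle2)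
  also have "dist (f x) (f z) \<le> dist x z"
    using assms by (simp add: semi_contraction_def)
  finally show ?thesis
    by (simp add: internal_functional_def)
qed

lemma abs_internal_functional_le: "\<bar>internal_functional x0 z y\<bar> \<le> dist x0 y"
  unfolding internal_functional_def
  using abs_dist_diff_le[of y z x0] by (simp add: dist_commute)

lemma compact_box:
  fixes r :: "'a \<Rightarrow> real"
  shows "compact {h. \<forall>y. \<bar>h y\<bar> \<le> r y}"
proof -
  have "compactin (product_topology (\<lambda>_. euclidean) UNIV) (PiE UNIV (\<lambda>y. {- r y .. r y}))"
    by (simp add: compactin_PiE)
  moreover have "PiE UNIV (\<lambda>y. {- r y .. r y}) = {h. \<forall>y. \<bar>h y\<bar> \<le> r y}"
    by (auto simp: PiE_UNIV_domain Pi_def abs_le_iff minus_le_iff)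
  ultimately show ?thesis
    by (simp add: euclidean_product_topology)
qed

text \<open>
  The space of functionals need not be first countable, so a sequence in a compact set need not have
  a convergent subsequence. Cluster points exist nevertheless, and lying in every closed set that
  contains a tail of the sequence is all that is needed of the limit.
\<close>

lemma compact_sequence_cluster_point:
  fixes s :: "nat \<Rightarrow> 'b::topological_space"
  assumes "compact K" and "\<And>n. s n \<in> K"
  obtains h where "\<And>S. closed S \<Longrightarrow> \<forall>\<^sub>F n in sequentially. s n \<in> S \<Longrightarrow> h \<in> S"
proof -
  let ?F = "filtermap s sequentially"
  have "?F \<noteq> bot" "\<forall>\<^sub>F g in ?F. g \<in> K"
    using assms(2) by (simp_all add: filtermap_bot_iff eventually_filtermap)
  then obtain h where h: "inf (nhds h) ?F \<noteq> bot"
    using assms(1) unfolding compact_filter by blast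
  show thesis
  proof
    fix S :: "'b set"
    assume S: "closed S" "\<forall>\<^sub>F n in sequentially. s n \<in> S"
    show "h \<in> S"
    proof (rule ccontr)
      assume "h \<notin> S"
      with S have "\<forall>\<^sub>F g in nhds h. g \<notin> S"
        using eventually_nhds_in_open[of "- S" h] by (simp add: open_Compl)
      moreover have "\<forall>\<^sub>F g in ?F. g \<in> S"
        using S by (simp add: eventually_filtermap)
      ultimately have "\<forall>\<^sub>F g in inf (nhds h) ?F. False"
        unfolding eventually_inf by blast
      with h show False
        by (simp add: trivial_limit_def)
    qed
  qed
qed

theorem proposition13:
  fixes x0 :: "'a::metric_space" and f :: "'a \<Rightarrow> 'a"
  assumes "semi_contraction f"
    and "min_displacement f = 0"
  shows "\<exists>h \<in> metric_functionals x0. \<forall>x. h (f x) \<le> h x"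
proof -
  have "\<exists>z. dist z (f z) < 1 / real (Suc n)" for n
    using assms(2) cInf_lessD[of "range (\<lambda>x. dist x (f x))" "1 / real (Suc n)"]
    by (auto simp: min_displacement_def)
  then obtain z where z: "\<And>n. dist (z n) (f (z n)) < 1 / real (Suc n)"
    by metis
  define s where "s n = internal_functional x0 (z n)" for n
  have "s n \<in> {h. \<forall>y. \<bar>h y\<bar> \<le> dist x0 y}" for n
    by (simp add: s_def abs_internal_functional_le)
  with compact_box obtain h
    where h: "\<And>S. closed S \<Longrightarrow> \<forall>\<^sub>F n in sequentially. s n \<in> S \<Longrightarrow> h \<in> S"
    by (rule compact_sequence_cluster_point[of _ s]) blast
  have "s n \<in> metric_functionals x0" for n
    unfolding s_def metric_functionals_def by (rule subsetD[OF closure_subset rangeI])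
  then have "h \<in> metric_functionals x0"
    by (intro h) (simp_all add: metric_functionals_def)
  moreover have "h (f x) \<le> h x" for x
  proof (rule field_le_epsilon)
    fix e :: real
    assume "e > 0"
    have "closed {g :: 'a \<Rightarrow> real. g (f x) \<le> g x + e}"
      by (intro closed_Collect_le continuous_intros continuous_on_product_coordinates)
    moreover have "\<forall>\<^sub>F n in sequentially. 1 / real (Suc n) < e"
      using LIMSEQ_inverse_real_of_nat \<open>e > 0\<close>
      by (auto simp: inverse_eq_divide dest: order_tendstoD(2))
    then have "\<forall>\<^sub>F n in sequentially. s n \<in> {g. g (f x) \<le> g x + e}"
    proof eventually_elim
      case (elim n)
      show ?case
        using internal_functional_image_le[OF assms(1), of x0 "z n" x] z[of n] elim
        by (simp add: s_def)
    qed
    ultimately have "h \<in> {g. g (f x) \<le> g x + e}"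
      by (rule h)
    then show "h (f x) \<le> h x + e"
      by simp
  qed
  ultimately show ?thesis
    by blast
qed

end
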